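(* Let $d\ge 1$ and let $\mathcal{S}\subset\{-1,0,1\}^d\setminus\{\mathbf{0}\}$ be a weighted step set that is symmetric over each of the first $d-1$ coordinate axes, that contains, for each $1\le j\le d$, a step with $j$th coordinate $+1$ and a step with $j$th coordinate $-1$, and that has zero drift, i.e. $A(\mathbf{1})=B(\mathbf{1})$. Let $s_n$ be the total weight of walks of length $n$ taking steps in $\mathcal{S}$, starting at the origin, and never leaving $\mathbb{N}^d$. Then, as $n\to\infty$, \[ s_n \sim S(\mathbf{1})^n \cdot n^{-d/2}\cdot \frac{S(\mathbf{1})^{d/2}}{\pi^{d/2}(b_1\cdots b_d)^{1/2}}. \]
   Context: Each step $\mathbf{i}\in\mathcal{S}$ carries a positive real weight $w_{\mathbf{i}}$; the weight of a walk is the product of the weights of its steps. The characteristic polynomial is the Laurent polynomial $S(\mathbf{z})=\sum_{\mathbf{i}\in\mathcal{S}} w_{\mathbf{i}} z_1^{i_1}\cdots z_d^{i_d}$. $\mathcal{S}$ is symmetric over the $k$th coordinate axis if $\mathcal{S}$ is invariant under negating the $k$th coordinate and each step has the same weight as its reflection. Writing $\hat{\mathbf{z}}=(z_1,\dots,z_{d-1})$, symmetry over the first $d-1$ axes means $S(\mathbf{z})=z_d^{-1}A(\hat{\mathbf{z}})+Q(\hat{\mathbf{z}})+z_dB(\hat{\mathbf{z}})$ for Laurent polynomials $A,Q,B$ invariant under $z_j\mapsto 1/z_j$ for each $j\le d-1$. $\mathbf{1}=(1,\dots,1)$. For $1\le k\le d$, $b_k=\sum_{\mathbf{i}\in\mathcal{S},\,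 i_k=1} w_{\mathbf{i}}$ is the total weight of steps moving forward in coordinate $k$. *)

theory Defs
  imports "HOL-Analysis.Analysis" "HOL-Library.Landau_Symbols"
begin

text \<open>Steps in dimension d are functions nat => int, coordinates indexed 0..d-1
  (coordinate k of the paper is index k-1), vanishing outside {0..<d}.\<close>

definition valid_step :: "nat \<Rightarrow> (nat \<Rightarrow> int) \<Rightarrow> bool" where
  "valid_step d s \<longleftrightarrow> (\<forall>j<d. s j \<in> {-1, 0, 1}) \<and> (\<forall>j\<ge>d. s j = 0) \<and> (\<exists>j<d. s j \<noteq> 0)"

definition reflect :: "nat \<Rightarrow> (nat \<Rightarrow> int) \<Rightarrow> (nat \<Rightarrow> int)" where
  "reflect k s = s(k := - s k)"

definition symmetric_over :: "(nat \<Rightarrow> int) set \<Rightarrow> ((nat \<Rightarrow> int) \<Rightarrow> real) \<Rightarrow> nat \<Rightarrow> bool" where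
  "symmetric_over S w k \<longleftrightarrow> (\<forall>s\<in>S. reflect k s \<in> S \<and> w (reflect k s) = w s)"

definition quadrant_walks :: "nat \<Rightarrow> (nat \<Rightarrow> int) set \<Rightarrow> nat \<Rightarrow> (nat \<Rightarrow> int) list set" where
  "quadrant_walks d S n = {ws. length ws = n \<and> set ws \<subseteq> S \<and>
      (\<forall>m\<le>n. \<forall>j<d. 0 \<le> (\<Sum>i<m. (ws ! i) j))}"

definition walk_weight :: "((nat \<Rightarrow> int) \<Rightarrow> real) \<Rightarrow> (nat \<Rightarrow> int) list \<Rightarrow> real" where
  "walk_weight w ws = prod_list (map w ws)"

definition total_quadrant_weight :: "nat \<Rightarrow> (nat \<Rightarrow> int) set \<Rightarrow> ((nat \<Rightarrow> int) \<Rightarrow> real) \<Rightarrow> nat \<Rightarrow> real" where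
  "total_quadrant_weight d S w n = (\<Sum>ws\<in>quadrant_walks d S n. walk_weight w ws)"

definition char_at_one :: "(nat \<Rightarrow> int) set \<Rightarrow> ((nat \<Rightarrow> int) \<Rightarrow> real) \<Rightarrow> real" where
  "char_at_one S w = (\<Sum>s\<in>S. w s)"

definition forward_weight :: "(nat \<Rightarrow> int) set \<Rightarrow> ((nat \<Rightarrow> int) \<Rightarrow> real) \<Rightarrow> nat \<Rightarrow> real" where
  "forward_weight S w k = (\<Sum>s\<in>{s\<in>S. s k = 1}. w s)"

definition backward_weight :: "(nat \<Rightarrow> int) set \<Rightarrow> ((nat \<Rightarrow> int) \<Rightarrow> real) \<Rightarrow> nat \<Rightarrow> real" where
  "backward_weight S w k = (\<Sum>s\<in>{s\<in>S. s k = -1}. w s)"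

end

theory Submission
  imports Defs "HOL-Probability.Characteristic_Functions" "HOL-Real_Asymp.Real_Asymp"
begin

text \<open>For \<open>k < d - 1\<close>, once the absolute values of all steps in direction \<open>k\<close> are known, symmetry
  makes their signs independent fair coins, also given everything that happens in the other
  coordinates. Averaging over the signs replaces the event that coordinate \<open>k\<close> stays
  nonnegative by the factor \<open>q(N\<^sub>k)\<close>, where \<open>N\<^sub>k\<close> counts the steps that move coordinate \<open>k\<close>
  and \<open>q(N) = binomial(N, N div 2) / 2\<^sup>N\<close> is the probability that a simple random walk stays
  nonnegative for \<open>N\<close> steps. After this only the event for the last coordinate is left, and its
  weight is the expectation of \<open>q(N)\<close> for the last coordinate because of zero drift.
  Wallis' product gives \<open>q(N) \<sim> sqrt(2 / (\<pi> N))\<close>, and by Chernoff's bound \<open>N\<^sub>k\<close> is within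
  \<open>\<epsilon> n\<close> of \<open>2 b\<^sub>k n / S(1)\<close> up to an exponentially small error, so each factor
  \<open>q(N\<^sub>k)\<close> contributes \<open>sqrt(S(1) / (\<pi> b\<^sub>k n))\<close>.\<close>

section \<open>Weighted sums over all walks of a fixed length, without positivity constraint\<close>

definition walk_sum ::
  "(nat \<Rightarrow> int) set \<Rightarrow> ((nat \<Rightarrow> int) \<Rightarrow> real) \<Rightarrow> nat \<Rightarrow> ((nat \<Rightarrow> int) list \<Rightarrow> real) \<Rightarrow> real" where
  "walk_sum S w n f = (\<Sum>ws\<in>{ws. set ws \<subseteq> S \<and> length ws = n}. walk_weight w ws * f ws)"

text \<open>The recursion carries the current height \<open>x\<close>, so removing the first step
  leaves a condition of the same shape. The starting height is tested as well.\<close>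

fun stays_nonneg :: "nat \<Rightarrow> int \<Rightarrow> (nat \<Rightarrow> int) list \<Rightarrow> bool" where
  "stays_nonneg k x [] = (0 \<le> x)"
| "stays_nonneg k x (s # ws) = (0 \<le> x \<and> stays_nonneg k (x + s k) ws)"

definition moves :: "nat \<Rightarrow> (nat \<Rightarrow> int) list \<Rightarrow> nat" where
  "moves k ws = length (filter (\<lambda>s. s k \<noteq> 0) ws)"

text \<open>\<open>q(N)\<close> of the overview is \<open>stay_prob N 0\<close>. Other starting
  heights occur because conditioning on the first step moves the start.\<close>

fun stay_prob :: "nat \<Rightarrow> int \<Rightarrow> real" where
  "stay_prob 0 x = of_bool (0 \<le> x)"
| "stay_prob (Suc N) x = of_bool (0 \<le> x) * (stay_prob N (x + 1) + stay_prob N (x - 1)) / 2"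

lemma walk_sum_0 [simp]: "walk_sum S w 0 f = f []"
proof -
  have "{ws. set ws \<subseteq> S \<and> length ws = 0} = {[]}" by auto
  then show ?thesis by (simp add: walk_sum_def walk_weight_def)
qed

lemma walk_sum_Suc:
  assumes "finite S"
  shows "walk_sum S w (Suc n) f = (\<Sum>s\<in>S. w s * walk_sum S w n (\<lambda>ws. f (s # ws)))"
proof -
  let ?L = "{ws. set ws \<subseteq> S \<and> length ws = n}"
  have "{ws. set ws \<subseteq> S \<and> length ws = Suc n} = (\<lambda>(s, ws). s # ws) ` (S \<times> ?L)"
    by (auto simp: length_Suc_conv image_iff)
  moreover have "inj_on (\<lambda>(s, ws). s # ws) (S \<times> ?L)"
    by (auto simp: inj_on_def)
  ultimately have "walk_sum S w (Suc n) f
      = (\<Sum>(s, ws)\<in>S \<times> ?L. w s * (walk_weight w ws * f (s # ws)))"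
    by (simp add: walk_sum_def sum.reindex walk_weight_def mult.assoc case_prod_unfold)
  also have "\<dots> = (\<Sum>s\<in>S. w s * walk_sum S w n (\<lambda>ws. f (s # ws)))"
    by (simp add: sum.cartesian_product[symmetric] walk_sum_def sum_distrib_left)
  finally show ?thesis .
qed

lemma walk_sum_cong:
  assumes "\<And>ws. set ws \<subseteq> S \<Longrightarrow> length ws = n \<Longrightarrow> f ws = g ws"
  shows "walk_sum S w n f = walk_sum S w n g"
  unfolding walk_sum_def using assms by (auto intro: sum.cong)

lemma walk_sum_mono:
  assumes "\<And>s. s \<in> S \<Longrightarrow> 0 \<le> w s"
    and "\<And>ws. set ws \<subseteq> S \<Longrightarrow> length ws = n \<Longrightarrow> f ws \<le> g ws"
  shows "walk_sum S w n f \<le> walk_sum S w n g"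
proof -
  have "0 \<le> walk_weight w ws" if "set ws \<subseteq> S" for ws
    using that assms(1) by (induction ws) (auto simp: walk_weight_def)
  then show ?thesis
    unfolding walk_sum_def using assms(2) by (auto intro!: sum_mono mult_left_mono)
qed

lemma walk_sum_add: "walk_sum S w n (\<lambda>ws. f ws + g ws) = walk_sum S w n f + walk_sum S w n g"
  by (simp add: walk_sum_def sum.distrib distrib_left)

lemma walk_sum_diff: "walk_sum S w n (\<lambda>ws. f ws - g ws) = walk_sum S w n f - walk_sum S w n g"
  by (simp add: walk_sum_def sum_subtractf right_diff_distrib)

lemma walk_sum_cmult: "walk_sum S w n (\<lambda>ws. c * f ws) = c * walk_sum S w n f"
  by (simp add: walk_sum_def sum_distrib_left mult_ac)

lemma walk_sum_abs_le:
  assumes "\<And>s. s \<in> S \<Longrightarrow> 0 \<le> w s"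
    and "\<And>ws. set ws \<subseteq> S \<Longrightarrow> length ws = n \<Longrightarrow> \<bar>f ws\<bar> \<le> g ws"
  shows "\<bar>walk_sum S w n f\<bar> \<le> walk_sum S w n g"
proof -
  have "walk_sum S w n f \<le> walk_sum S w n g"
    by (rule walk_sum_mono[OF assms(1)]) (use assms(2) in \<open>force simp: abs_le_iff\<close>)+
  moreover have "walk_sum S w n (\<lambda>ws. - 1 * f ws) \<le> walk_sum S w n g"
    by (rule walk_sum_mono[OF assms(1)]) (use assms(2) in \<open>force simp: abs_le_iff\<close>)+
  ultimately show ?thesis
    unfolding walk_sum_cmult by linarith
qed

text \<open>With the tail \<open>ws\<close> fixed, the sum over first steps becomes the inner one;
  there, opposite signs can be paired.\<close>

lemma walk_sum_weighted_sum:
  "(\<Sum>s\<in>A. w s * walk_sum S w n (f s)) = walk_sum S w n (\<lambda>ws. \<Sum>s\<in>A. w s * f s ws)"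
  unfolding walk_sum_def sum_distrib_left by (subst sum.swap) (simp add: mult_ac)

text \<open>The exponential factors over the steps, so this moment generating function is an
  \<open>n\<close>-th power. At \<open>t = 0\<close> it gives the total weight of all walks.\<close>

lemma walk_sum_exp_moves:
  assumes "finite S"
  shows "walk_sum S w n (\<lambda>ws. exp (t * real (moves k ws)))
    = (\<Sum>s\<in>S. w s * exp (t * of_bool (s k \<noteq> 0))) ^ n"
proof (induction n)
  case (Suc n)
  have "walk_sum S w (Suc n) (\<lambda>ws. exp (t * real (moves k ws)))
    = (\<Sum>s\<in>S. w s * walk_sum S w n
         (\<lambda>ws. exp (t * of_bool (s k \<noteq> 0)) * exp (t * real (moves k ws))))"
    unfolding walk_sum_Suc[OF assms]
    by (intro sum.cong refl arg_cong2[where f = "(*)"] walk_sum_cong)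
       (simp add: moves_def exp_add[symmetric] algebra_simps)
  then show ?case
    by (simp only: walk_sum_cmult Suc.IH sum_distrib_right power_Suc mult.assoc)
qed (simp add: moves_def)

section \<open>Averaging over the signs in one direction\<close>

lemma stay_prob_neg: "x < 0 \<Longrightarrow> stay_prob N x = 0"
  by (cases N) auto

lemma stay_prob_bounds: "0 \<le> stay_prob N x \<and> stay_prob N x \<le> 1"
proof (induction N arbitrary: x)
  case (Suc N)
  from Suc[of "x + 1"] Suc[of "x - 1"] show ?case by auto
qed auto

text \<open>The predicate \<open>P\<close> abstracts the two situations in which the sign of a step in
  direction \<open>k\<close> can be averaged out: \<open>f\<close> ignores the signs in direction \<open>k\<close> and the weights are
  symmetric, or \<open>f\<close> is constant and only the total forward and backward weights agree.\<close>

lemma walk_sum_stays_nonneg: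
  assumes fin: "finite S" and small: "\<And>s. s \<in> S \<Longrightarrow> s k \<in> {-1, 0, 1}"
    and step: "\<And>f s. P f \<Longrightarrow> s \<in> S \<Longrightarrow> P (\<lambda>ws. f (s # ws))"
    and sym: "\<And>f ws (h :: int \<Rightarrow> real). P f \<Longrightarrow>
      (\<Sum>s\<in>S. w s * (h (s k) * f (s # ws))) = (\<Sum>s\<in>S. w s * (h (- s k) * f (s # ws)))"
    and "P f"
  shows "walk_sum S w n (\<lambda>ws. of_bool (stays_nonneg k x ws) * f ws)
    = walk_sum S w n (\<lambda>ws. stay_prob (moves k ws) x * f ws)"
  using \<open>P f\<close>
proof (induction n arbitrary: x f)
  case (Suc n)
  show ?case
  proof (cases "0 \<le> x")
    case False
    then have "\<not> stays_nonneg k x ws" for ws by (cases ws) auto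
    with False show ?thesis by (simp add: stay_prob_neg)
  next
    case True
    have "walk_sum S w (Suc n) (\<lambda>ws. of_bool (stays_nonneg k x ws) * f ws)
      = (\<Sum>s\<in>S. w s * walk_sum S w n (\<lambda>ws. of_bool (stays_nonneg k (x + s k) ws) * f (s # ws)))"
      using True by (simp add: walk_sum_Suc[OF fin])
    also have "\<dots> = (\<Sum>s\<in>S. w s * walk_sum S w n
         (\<lambda>ws. stay_prob (moves k ws) (x + s k) * f (s # ws)))"
      using Suc.IH step[OF Suc.prems] by (intro sum.cong refl) auto
    also have "\<dots> = walk_sum S w n
         (\<lambda>ws. \<Sum>s\<in>S. w s * (stay_prob (moves k ws) (x + s k) * f (s # ws)))"
      by (rule walk_sum_weighted_sum)
    also have "\<dots> = walk_sum S w n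
         (\<lambda>ws. \<Sum>s\<in>S. w s * (stay_prob (moves k (s # ws)) x * f (s # ws)))"
    proof (rule walk_sum_cong)
      fix ws
      let ?q = "stay_prob (moves k ws)"
      \<comment> \<open>By \<open>sym\<close> the sum equals its mirror image, hence also the mean
        of the two.\<close>
      have "(\<Sum>s\<in>S. w s * (?q (x + s k) * f (s # ws)))
        = ((\<Sum>s\<in>S. w s * (?q (x + s k) * f (s # ws)))
           + (\<Sum>s\<in>S. w s * (?q (x + - s k) * f (s # ws)))) / 2"
        using sym[OF Suc.prems, of "\<lambda>y. ?q (x + y)" ws] by simp
      also have "\<dots> = (\<Sum>s\<in>S. w s * ((?q (x + s k) + ?q (x - s k)) / 2 * f (s # ws)))"
        by (simp add: sum.distrib[symmetric] sum_divide_distrib field_simps)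
      \<comment> \<open>If \<open>s k = 0\<close>, height and move count are unchanged and the mean
        collapses to \<open>?q x\<close>. Otherwise the mean is the recursion of
        \<open>stay_prob\<close> for one more move.\<close>
      also have "\<dots> = (\<Sum>s\<in>S. w s * (stay_prob (moves k (s # ws)) x * f (s # ws)))"
        using small True by (intro sum.cong refl) (fastforce simp: moves_def)
      finally show "(\<Sum>s\<in>S. w s * (?q (x + s k) * f (s # ws)))
        = (\<Sum>s\<in>S. w s * (stay_prob (moves k (s # ws)) x * f (s # ws)))" .
    qed
    also have "\<dots> = walk_sum S w (Suc n) (\<lambda>ws. stay_prob (moves k ws) x * f ws)"
      by (simp add: walk_sum_Suc[OF fin] walk_sum_weighted_sum)
    finally show ?thesis .
  qed
qed (simp add: moves_def)

section \<open>The simple random walk: reflection principle and binomial law\<close>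

fun srw_mass :: "nat \<Rightarrow> int \<Rightarrow> real" where
  "srw_mass 0 y = of_bool (y = 0)"
| "srw_mass (Suc N) y = (srw_mass N (y - 1) + srw_mass N (y + 1)) / 2"

text \<open>The distribution function of the position after \<open>N\<close> steps from 0. It has
  its own recursion, so that it can be compared with \<open>stay_prob\<close> by induction.\<close>

fun srw_cdf :: "nat \<Rightarrow> int \<Rightarrow> real" where
  "srw_cdf 0 y = of_bool (0 \<le> y)"
| "srw_cdf (Suc N) y = (srw_cdf N (y - 1) + srw_cdf N (y + 1)) / 2"

lemma srw_cdf_diff: "srw_cdf N y - srw_cdf N (y - 1) = srw_mass N y"
proof (induction N arbitrary: y)
  case (Suc N)
  from Suc[of "y - 1"] Suc[of "y + 1"] show ?case by (simp add: field_simps)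
qed auto

text \<open>Reflection principle: both sides satisfy the same recursion and vanish at \<open>x = -1\<close>.\<close>

lemma stay_prob_eq_srw_cdf: "-1 \<le> x \<Longrightarrow> stay_prob N x = srw_cdf N (x + 1) - srw_cdf N (- x - 1)"
proof (induction N arbitrary: x)
  case (Suc N)
  show ?case
  proof (cases "x = -1")
    case False
    then have "-1 \<le> x + 1" "-1 \<le> x - 1" "0 \<le> x" using Suc.prems by auto
    then show ?thesis using Suc.IH[of "x + 1"] Suc.IH[of "x - 1"]
      by (simp add: field_simps)
  qed auto
qed auto

lemma srw_mass_eq_0: "y < - int N \<or> int N < y \<or> odd (y + int N) \<Longrightarrow> srw_mass N y = 0"
proof (induction N arbitrary: y)
  case (Suc N)
  have "srw_mass N (y - 1) = 0" by (rule Suc.IH) (use Suc.prems in auto)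
  moreover have "srw_mass N (y + 1) = 0" by (rule Suc.IH) (use Suc.prems in auto)
  ultimately show ?case by simp
qed auto

text \<open>Position \<open>2 j - N\<close> means that exactly \<open>j\<close> of the
  \<open>N\<close> steps go up; the induction step is Pascal's rule.\<close>

lemma srw_mass_binomial: "srw_mass N (2 * int j - int N) = real (N choose j) / 2 ^ N"
proof (induction N arbitrary: j)
  case 0
  then show ?case by (cases j) auto
next
  case (Suc N)
  have "2 * int j - int (Suc N) + 1 = 2 * int j - int N" by simp
  then have up: "srw_mass N (2 * int j - int (Suc N) + 1) = real (N choose j) / 2 ^ N"
    using Suc[of j] by simp
  show ?case
  proof (cases j)
    case 0
    then show ?thesis using up srw_mass_eq_0[of "- 2 - int N" N] by simp
  next
    case (Suc i)
    then have "2 * int j - int (Suc N) - 1 = 2 * int i - int N" by simp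
    then have "srw_mass N (2 * int j - int (Suc N) - 1) = real (N choose i) / 2 ^ N"
      using Suc.IH[of i] by (simp only:)
    then show ?thesis using up Suc by (simp add: field_simps)
  qed
qed


declare stay_prob.simps(2) [simp del] srw_mass.simps(2) [simp del]

text \<open>For start 0, reflection leaves the probability of ending in the interval (-1, 1], which
  holds just the points 0 and 1. Parity of \<open>N\<close> makes one of the two masses
  vanish.\<close>

lemma stay_prob_eq_srw_mass: "stay_prob N 0 = srw_mass N 0 + srw_mass N 1"
  using stay_prob_eq_srw_cdf[of 0 N] srw_cdf_diff[of N 0] srw_cdf_diff[of N 1] by simp

section \<open>Central binomial coefficients and Wallis' product\<close>

lemma stay_prob_even: "stay_prob (2 * m) 0 = real (2 * m choose m) / 4 ^ m"
  using srw_mass_binomial[of "2 * m" m] srw_mass_eq_0[of 1 "2 * m"]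
  by (simp add: stay_prob_eq_srw_mass power_mult)

lemma stay_prob_odd: "stay_prob (2 * m + 1) 0 = real (2 * m + 1 choose (m + 1)) / (2 * 4 ^ m)"
proof -
  have "2 * int (m + 1) - int (2 * m + 1) = 1" by simp
  then have "srw_mass (2 * m + 1) 1 = real (2 * m + 1 choose (m + 1)) / 2 ^ (2 * m + 1)"
    using srw_mass_binomial[of "2 * m + 1" "m + 1"] by metis
  moreover have "srw_mass (2 * m + 1) 0 = 0" by (rule srw_mass_eq_0) simp
  moreover have "(2::real) ^ (2 * m + 1) = 2 * 4 ^ m" by (simp add: power_mult)
  ultimately show ?thesis by (simp only: stay_prob_eq_srw_mass)
qed

text \<open>In terms of the walk: a survivor of \<open>2 m\<close> steps is at 0 with probability
  \<open>1 / (m + 1)\<close> (Catalan number over central binomial coefficient), and half of those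
  leave at the next step.\<close>

lemma stay_prob_odd_eq:
  "stay_prob (2 * m + 1) 0 = stay_prob (2 * m) 0 * (2 * real m + 1) / (2 * (real m + 1))"
proof -
  have "Suc m * (Suc (2 * m) choose Suc m) = Suc (2 * m) * (2 * m choose m)"
    by (rule Suc_times_binomial)
  then have "real (Suc m * (Suc (2 * m) choose Suc m)) = real (Suc (2 * m) * (2 * m choose m))"
    by (rule arg_cong)
  then have "(real m + 1) * real (2 * m + 1 choose (m + 1)) = (2 * real m + 1) * real (2 * m choose m)"
    by (simp add: algebra_simps del: binomial_Suc_Suc)
  then have "real (2 * m + 1 choose (m + 1)) = (2 * real m + 1) * real (2 * m choose m) / (real m + 1)"
    by (simp add: field_simps del: binomial_Suc_Suc)
  then show ?thesis
    by (simp only: stay_prob_odd stay_prob_even) (simp add: field_simps)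
qed

text \<open>After an odd number of steps the position is odd, so a surviving walk has height at
  least 1 and survives one more step.\<close>

lemma stay_prob_even_Suc: "stay_prob (2 * Suc m) 0 = stay_prob (2 * m + 1) 0"
proof -
  have "2 * Suc m choose Suc m = (2 * m + 1 choose m) + (2 * m + 1 choose Suc m)" by simp
  also have "2 * m + 1 choose m = (2 * m + 1 choose Suc m)"
    by (subst binomial_symmetric) auto
  finally have "2 * Suc m choose Suc m = 2 * (2 * m + 1 choose (m + 1))" by simp
  then have "stay_prob (2 * Suc m) 0 = real (2 * (2 * m + 1 choose (m + 1))) / 4 ^ Suc m"
    by (simp only: stay_prob_even)
  then show ?thesis
    unfolding stay_prob_odd by (simp del: binomial_Suc_Suc)
qed

text \<open>From \<open>m\<close> to \<open>m + 1\<close> the factor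
  \<open>(stay_prob (2 * m) 0)\<^sup>2 * (2 * real m + 1)\<close> changes by exactly the reciprocal
  of a Wallis factor. The exact identity turns the limit pi/2 of the product into the asymptotics of
  \<open>stay_prob\<close>.\<close>

lemma stay_prob_wallis:
  "(stay_prob (2 * m) 0)\<^sup>2 * (2 * real m + 1) * (\<Prod>k=1..m. (4 * real k ^ 2) / (4 * real k ^ 2 - 1)) = 1"
proof (induction m)
  case (Suc m)
  have ne: "2 * real m + 1 \<noteq> 0" "2 * real m + 3 \<noteq> 0" "real m + 1 \<noteq> 0" by linarith+
  have den: "4 * (real (Suc m))\<^sup>2 - 1 = (2 * real m + 1) * (2 * real m + 3)"
    by (simp add: power2_eq_square algebra_simps)
  have "(stay_prob (2 * Suc m) 0)\<^sup>2 * (2 * real (Suc m) + 1) * (4 * real (Suc m) ^ 2 / (4 * real (Suc m) ^ 2 - 1))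
    = (stay_prob (2 * m) 0)\<^sup>2 * ((2 * real m + 1)\<^sup>2 / (2 * (real m + 1))\<^sup>2 * (2 * real m + 3)
       * (4 * (real m + 1)\<^sup>2 / ((2 * real m + 1) * (2 * real m + 3))))"
    unfolding stay_prob_even_Suc stay_prob_odd_eq den
    by (simp add: power_mult_distrib power_divide add.commute)
  also have "(2 * real m + 1)\<^sup>2 / (2 * (real m + 1))\<^sup>2 * (2 * real m + 3)
       * (4 * (real m + 1)\<^sup>2 / ((2 * real m + 1) * (2 * real m + 3))) = 2 * real m + 1"
    using ne by (simp add: power2_eq_square divide_simps) (simp add: algebra_simps)
  finally have step: "(stay_prob (2 * Suc m) 0)\<^sup>2 * (2 * real (Suc m) + 1)
      * (4 * real (Suc m) ^ 2 / (4 * real (Suc m) ^ 2 - 1)) = (stay_prob (2 * m) 0)\<^sup>2 * (2 * real m + 1)" .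
  have "(\<Prod>k=1..Suc m. (4 * real k ^ 2) / (4 * real k ^ 2 - 1))
    = (4 * real (Suc m) ^ 2 / (4 * real (Suc m) ^ 2 - 1)) * (\<Prod>k=1..m. (4 * real k ^ 2) / (4 * real k ^ 2 - 1))"
    by (simp add: mult.commute)
  then show ?case using Suc.IH step by (simp only: mult.assoc[symmetric])
qed simp

lemma stay_prob_asymptotics: "(\<lambda>N. sqrt (real N) * stay_prob N 0) \<longlonglongrightarrow> sqrt (2 / pi)"
proof -
  let ?W = "\<lambda>m. \<Prod>k=1..m. (4 * real k ^ 2) / (4 * real k ^ 2 - 1)"
  let ?c = "\<lambda>m. stay_prob (2 * m) 0 * sqrt (2 * real m + 1)"
  have "?c m = sqrt (inverse (?W m))" for m
  proof -
    have "?W m * ((stay_prob (2 * m) 0)\<^sup>2 * (2 * real m + 1)) = 1"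
      by (subst mult.commute) (rule stay_prob_wallis)
    then have "inverse (?W m) = (stay_prob (2 * m) 0)\<^sup>2 * (2 * real m + 1)"
      by (rule inverse_unique)
    moreover have "sqrt ((stay_prob (2 * m) 0)\<^sup>2 * (2 * real m + 1)) = ?c m"
      using stay_prob_bounds[of "2 * m" 0] by (simp add: real_sqrt_mult)
    ultimately show ?thesis by (simp only:)
  qed
  moreover have "(\<lambda>m. sqrt (inverse (?W m))) \<longlonglongrightarrow> sqrt (inverse (pi / 2))"
    by (intro tendsto_intros wallis) auto
  ultimately have c: "?c \<longlonglongrightarrow> sqrt (2 / pi)" by simp
  have "(\<lambda>m. ?c m * sqrt (2 * real m / (2 * real m + 1))) \<longlonglongrightarrow> sqrt (2 / pi) * 1"
    by (intro tendsto_mult c) real_asymp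
  then have even: "(\<lambda>m. sqrt (real (2 * m)) * stay_prob (2 * m) 0) \<longlonglongrightarrow> sqrt (2 / pi)"
    by (simp add: real_sqrt_divide mult_ac)
  have "(\<lambda>m. ?c m * ((2 * real m + 1) / (2 * (real m + 1)))) \<longlonglongrightarrow> sqrt (2 / pi) * 1"
    by (intro tendsto_mult c) real_asymp
  then have "(\<lambda>m. sqrt (real (2 * m + 1)) * stay_prob (2 * m + 1) 0) \<longlonglongrightarrow> sqrt (2 / pi)"
    unfolding stay_prob_odd_eq by (simp add: mult_ac add.commute)
  with even show ?thesis
    by (rule limseq_even_odd)
qed

section \<open>Concentration of the number of moves\<close>

lemma tendsto_sqrt_mult_of_ratio:
  fixes h :: "nat \<Rightarrow> real"
  assumes lim: "(\<lambda>N. sqrt (real N) * h N) \<longlonglongrightarrow> c" and "0 < p" "0 < e"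
  obtains \<delta> where "0 < \<delta>"
    "\<forall>\<^sub>F n in sequentially. \<forall>N. \<bar>real N - p * real n\<bar> \<le> \<delta> * real n \<longrightarrow>
       \<bar>sqrt (real n) * h N - c / sqrt p\<bar> \<le> e"
proof -
  \<comment> \<open>The quantity to control is \<open>sqrt N * h N\<close> divided by
    \<open>sqrt (N / n)\<close>. Joint continuity of the quotient at \<open>(c, p)\<close> makes the
    bound uniform over all \<open>N\<close> in the window.\<close>
  have "((\<lambda>z. fst z / sqrt (snd z)) \<longlongrightarrow> c / sqrt p) (nhds c \<times>\<^sub>F nhds p)"
    using \<open>0 < p\<close>
    by (intro tendsto_divide tendsto_real_sqrt filterlim_fst filterlim_snd) auto
  then have "\<forall>\<^sub>F z in nhds c \<times>\<^sub>F nhds p. dist (fst z / sqrt (snd z)) (c / sqrt p) < e"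
    using \<open>0 < e\<close> by (rule tendstoD)
  then obtain P Q where PQ: "eventually P (nhds c)" "eventually Q (nhds p)"
    "\<And>a b. P a \<Longrightarrow> Q b \<Longrightarrow> dist (a / sqrt b) (c / sqrt p) < e"
    by (auto simp: eventually_prod_filter)
  from PQ(2) obtain \<eta> where \<eta>: "0 < \<eta>" "\<And>b. dist b p < \<eta> \<Longrightarrow> Q b"
    by (auto simp: eventually_nhds_metric)
  have "\<forall>\<^sub>F N in sequentially. P (sqrt (real N) * h N)"
    using lim PQ(1) by (auto simp: filterlim_iff)
  then obtain M where M: "\<And>N. M \<le> N \<Longrightarrow> P (sqrt (real N) * h N)"
    by (auto simp: eventually_sequentially)
  \<comment> \<open>\<open>\<eta> / 2\<close> keeps \<open>N / n\<close> strictly within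
    \<open>\<eta>\<close> of \<open>p\<close>; \<open>p / 2\<close> forces
    \<open>N \<ge> p n / 2\<close>, so that \<open>N\<close> grows with \<open>n\<close>.\<close>
  define \<delta> where "\<delta> = min (\<eta> / 2) (p / 2)"
  have \<delta>: "0 < \<delta>" "\<delta> < \<eta>" "\<delta> \<le> p / 2" using \<eta>(1) \<open>0 < p\<close> by (auto simp: \<delta>_def)
  have "filterlim (\<lambda>n. p / 2 * real n) at_top sequentially"
    using \<open>0 < p\<close> by real_asymp
  then have "\<forall>\<^sub>F n in sequentially. real M + 1 \<le> p / 2 * real n"
    unfolding filterlim_at_top by blast
  then have "\<forall>\<^sub>F n in sequentially. \<forall>N. \<bar>real N - p * real n\<bar> \<le> \<delta> * real n \<longrightarrow>
       \<bar>sqrt (real n) * h N - c / sqrt p\<bar> \<le> e"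
    using eventually_gt_at_top[of 0]
  proof (eventually_elim, intro allI impI)
    fix n N :: nat
    assume n: "real M + 1 \<le> p / 2 * real n" "0 < n"
      and N: "\<bar>real N - p * real n\<bar> \<le> \<delta> * real n"
    have "\<delta> * real n \<le> p / 2 * real n" using \<delta>(3) by (intro mult_right_mono) auto
    then have "real M + 1 \<le> real N" using n(1) N by linarith
    then have "M \<le> N" "0 < N" by linarith+
    have "real N / real n - p = (real N - p * real n) / real n" using n(2) by (simp add: field_simps)
    then have "\<bar>real N / real n - p\<bar> \<le> \<delta>" using n(2) N by (simp add: field_simps)
    then have "Q (real N / real n)" using \<delta>(2) by (intro \<eta>(2)) (simp add: dist_real_def)
    from PQ(3)[OF M[OF \<open>M \<le> N\<close>] this]
    have "\<bar>sqrt (real N) * h N / sqrt (real N / real n) - c / sqrt p\<bar> < e"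
      by (simp add: dist_real_def)
    also have "sqrt (real N) * h N / sqrt (real N / real n) = sqrt (real n) * h N"
      using n(2) \<open>0 < N\<close> by (simp add: real_sqrt_divide)
    finally show "\<bar>sqrt (real n) * h N - c / sqrt p\<bar> \<le> e" by simp
  qed
  with \<delta>(1) show thesis by (rule that)
qed

text \<open>The function of \<open>t\<close> equals 1 at 0 and has derivative
  \<open>- \<delta>\<close> there, so it drops below 1 at once. Taking \<open>\<sigma>\<close> as 1
  or -1 serves the upper or lower tail.\<close>

lemma chernoff_rate:
  fixes p \<sigma> \<delta> :: real
  assumes "0 < \<delta>"
  obtains t where "0 < t" "(1 - p + p * exp (\<sigma> * t)) * exp (- (\<sigma> * p + \<delta>) * t) < 1"
proof -
  let ?f = "\<lambda>t. (1 - p + p * exp (\<sigma> * t)) * exp (- (\<sigma> * p + \<delta>) * t)"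
  have "(?f has_real_derivative - \<delta>) (at 0)"
    by (auto intro!: derivative_eq_intros)
  from DERIV_neg_dec_right[OF this] \<open>0 < \<delta>\<close>
  obtain d where d: "0 < d" "\<And>h. 0 < h \<Longrightarrow> h < d \<Longrightarrow> ?f (0 + h) < ?f 0" by auto
  from d(2)[of "d / 2"] d(1) show thesis by (intro that[of "d / 2"]) auto
qed

text \<open>One more factor \<open>stay_prob\<close> costs a power \<open>n\<close> to the -1/2 and
  a constant. However \<open>g\<close> correlates with the moves, \<open>sqrt n * stay_prob\<close>
  is nearly the constant \<open>c\<close> outside an exponentially small part of the weight.\<close>

lemma walk_sum_stay_prob_asymptotics:
  fixes S w k
  defines "W \<equiv> sum w S" and "M \<equiv> (\<Sum>s\<in>{s\<in>S. s k \<noteq> 0}. w s)"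
  assumes fin: "finite S" and w: "\<And>s. s \<in> S \<Longrightarrow> 0 \<le> w s" and "0 < M"
    and g: "\<And>ws. 0 \<le> g ws" "\<And>ws. g ws \<le> 1"
    and lim: "(\<lambda>n. walk_sum S w n g / W ^ n * real n powr r) \<longlonglongrightarrow> C"
  shows "(\<lambda>n. walk_sum S w n (\<lambda>ws. stay_prob (moves k ws) 0 * g ws) / W ^ n * real n powr (r + 1 / 2))
    \<longlonglongrightarrow> C * sqrt (2 * W / (pi * M))"
proof -
  have "M \<le> W" unfolding M_def W_def by (rule sum_mono2) (use fin w in auto)
  then have "0 < W" using \<open>0 < M\<close> by simp
  define p where "p = M / W"
  have "0 < p" using \<open>0 < M\<close> \<open>0 < W\<close> by (simp add: p_def)
  define c where "c = sqrt (2 / pi) / sqrt p"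
  have "0 < c" using \<open>0 < p\<close> by (simp add: c_def)
  define E where "E n f = walk_sum S w n f / W ^ n" for n f
  \<comment> \<open>Under the normalized weights the number of moves is binomial with parameters
    \<open>n\<close> and \<open>p\<close>.\<close>
  have mgf: "E n (\<lambda>ws. exp (t * real (moves k ws))) = (1 - p + p * exp t) ^ n" for n t
  proof -
    have "(\<Sum>s\<in>S. w s * exp (t * of_bool (s k \<noteq> 0)))
        = (\<Sum>s\<in>S. w s + (exp t - 1) * (if s k \<noteq> 0 then w s else 0))"
      by (intro sum.cong) (auto simp: algebra_simps)
    also have "\<dots> = W + (exp t - 1) * M"
      using fin unfolding W_def M_def sum.distrib sum_distrib_left[symmetric]
      by (simp add: sum.inter_filter)
    also have "\<dots> = W * (1 - p + p * exp t)"
      using \<open>0 < W\<close> by (simp add: p_def field_simps)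
    finally show ?thesis
      using \<open>0 < W\<close> by (simp add: E_def walk_sum_exp_moves[OF fin] power_mult_distrib)
  qed
  have "(\<lambda>n. E n (\<lambda>ws. (sqrt (real n) * stay_prob (moves k ws) 0 - c) * g ws) * real n powr r) \<longlonglongrightarrow> 0"
  proof (rule tendstoI)
    fix e :: real assume "0 < e"
    \<comment> \<open>This makes \<open>\<epsilon> * C\<close>, the limit of the final bound, at
      most \<open>e / 2\<close>; the added 1 covers \<open>C = 0\<close>.\<close>
    define \<epsilon> where "\<epsilon> = e / (2 * (\<bar>C\<bar> + 1))"
    have "0 < \<epsilon>" using \<open>0 < e\<close> by (simp add: \<epsilon>_def)
    obtain \<delta> where \<delta>: "0 < \<delta>"
      "\<forall>\<^sub>F n in sequentially. \<forall>N. \<bar>real N - p * real n\<bar> \<le> \<delta> * real n \<longrightarrow>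
       \<bar>sqrt (real n) * stay_prob N 0 - c\<bar> \<le> \<epsilon>"
      using tendsto_sqrt_mult_of_ratio[OF stay_prob_asymptotics \<open>0 < p\<close> \<open>0 < \<epsilon>\<close>]
      unfolding c_def by blast
    define F where "F \<sigma> t = (1 - p + p * exp (\<sigma> * t)) * exp (- (\<sigma> * p + \<delta>) * t)" for \<sigma> t :: real
    obtain t where t: "0 < t" "F 1 t < 1"
      using chernoff_rate[OF \<delta>(1), of p 1] unfolding F_def by blast
    obtain u where u: "0 < u" "F (-1) u < 1"
      using chernoff_rate[OF \<delta>(1), of p "-1"] unfolding F_def by blast
    have "p \<le> 1" using \<open>M \<le> W\<close> \<open>0 < W\<close> by (simp add: p_def)
    have F_pos: "0 < F \<sigma> x" for \<sigma> x
    proof -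
      have "0 < 1 - p + p * exp (\<sigma> * x)"
        using \<open>p \<le> 1\<close> \<open>0 < p\<close> by (intro add_nonneg_pos) auto
      then show ?thesis by (simp add: F_def)
    qed
    \<comment> \<open>An exponential majorant of the tail on side \<open>\<sigma>\<close>, as in
      Markov's inequality: it is at least 1 wherever
      \<open>\<sigma> (N - p n) \<ge> \<delta> n\<close>.\<close>
    define T where "T \<sigma> x n N = exp (x * (\<sigma> * (real N - p * real n) - \<delta> * real n))"
      for \<sigma> x :: real and n N :: nat
    have ET: "E n (\<lambda>ws. T \<sigma> x n (moves k ws)) = F \<sigma> x ^ n" for \<sigma> x n
    proof -
      have "T \<sigma> x n N = exp (- (\<sigma> * p + \<delta>) * x) ^ n * exp (\<sigma> * x * real N)" for N
        by (simp add: T_def exp_of_nat_mult[symmetric] exp_add[symmetric] algebra_simps)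
      then have "E n (\<lambda>ws. T \<sigma> x n (moves k ws))
          = exp (- (\<sigma> * p + \<delta>) * x) ^ n * E n (\<lambda>ws. exp (\<sigma> * x * real (moves k ws)))"
        by (simp add: E_def walk_sum_cmult)
      then show ?thesis by (simp only: mgf F_def power_mult_distrib mult.commute)
    qed
    have "\<forall>\<^sub>F n in sequentially.
      \<bar>E n (\<lambda>ws. (sqrt (real n) * stay_prob (moves k ws) 0 - c) * g ws)\<bar>
        \<le> \<epsilon> * E n g + (sqrt (real n) + c) * (F 1 t ^ n + F (-1) u ^ n)"
      using \<delta>(2)
    proof eventually_elim
      case (elim n)
      \<comment> \<open>Inside the window the first term suffices. Outside it, one of the two
        majorants is at least 1 and the crude bound \<open>sqrt n + c\<close> is affordable.\<close>
      have "\<bar>(sqrt (real n) * stay_prob N 0 - c) * g ws\<bar>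
          \<le> \<epsilon> * g ws + (sqrt (real n) + c) * (T 1 t n N + T (-1) u n N)" for N ws
      proof (cases "\<bar>real N - p * real n\<bar> \<le> \<delta> * real n")
        case True
        then have "\<bar>sqrt (real n) * stay_prob N 0 - c\<bar> * g ws \<le> \<epsilon> * g ws"
          using elim g by (intro mult_right_mono) auto
        moreover have "0 \<le> (sqrt (real n) + c) * (T 1 t n N + T (-1) u n N)"
          using \<open>0 < c\<close> by (intro mult_nonneg_nonneg) (auto simp: T_def)
        ultimately show ?thesis using g by (simp add: abs_mult)
      next
        case False
        have "sqrt (real n) * stay_prob N 0 \<le> sqrt (real n) * 1" "0 \<le> sqrt (real n) * stay_prob N 0"
          using stay_prob_bounds[of N 0] by (intro mult_left_mono mult_nonneg_nonneg; simp)+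
        then have "\<bar>sqrt (real n) * stay_prob N 0 - c\<bar> \<le> sqrt (real n) + c"
          using \<open>0 < c\<close> by linarith
        then have "\<bar>sqrt (real n) * stay_prob N 0 - c\<bar> * g ws \<le> (sqrt (real n) + c) * 1"
          using g by (intro mult_mono) auto
        moreover have "1 \<le> T 1 t n N + T (-1) u n N"
        proof (cases "real N - p * real n > 0")
          case True
          with False have "1 \<le> T 1 t n N" using t(1) by (simp add: T_def)
          then show ?thesis by (simp add: T_def add_increasing2)
        next
          case neg: False
          with False have "1 \<le> T (-1) u n N" using u(1) by (simp add: T_def)
          then show ?thesis by (simp add: T_def add_increasing)
        qed
        then have "(sqrt (real n) + c) * 1 \<le> (sqrt (real n) + c) * (T 1 t n N + T (-1) u n N)"
          using \<open>0 < c\<close> by (intro mult_left_mono) auto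
        moreover have "0 \<le> \<epsilon> * g ws" using \<open>0 < \<epsilon>\<close> g by simp
        ultimately show ?thesis using g by (simp add: abs_mult)
      qed
      then have "\<bar>walk_sum S w n (\<lambda>ws. (sqrt (real n) * stay_prob (moves k ws) 0 - c) * g ws)\<bar>
        \<le> walk_sum S w n (\<lambda>ws. \<epsilon> * g ws + (sqrt (real n) + c) * (T 1 t n (moves k ws) + T (-1) u n (moves k ws)))"
        using w by (intro walk_sum_abs_le) auto
      then have "\<bar>E n (\<lambda>ws. (sqrt (real n) * stay_prob (moves k ws) 0 - c) * g ws)\<bar>
        \<le> walk_sum S w n (\<lambda>ws. \<epsilon> * g ws + (sqrt (real n) + c) * (T 1 t n (moves k ws) + T (-1) u n (moves k ws))) / W ^ n"
        using \<open>0 < W\<close> by (simp add: E_def abs_divide divide_right_mono)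
      also have "\<dots> = \<epsilon> * E n g + (sqrt (real n) + c) *
          (E n (\<lambda>ws. T 1 t n (moves k ws)) + E n (\<lambda>ws. T (-1) u n (moves k ws)))"
        by (simp add: E_def walk_sum_add walk_sum_cmult add_divide_distrib distrib_left)
      finally show ?case unfolding ET .
    qed
    moreover have "\<forall>\<^sub>F n in sequentially. (\<epsilon> * E n g + (sqrt (real n) + c) * (F 1 t ^ n + F (-1) u ^ n)) * real n powr r < e"
    proof -
      have "(\<lambda>n. (sqrt (real n) + c) * a ^ n * real n powr r) \<longlonglongrightarrow> 0" if "0 < a" "a < 1" for a
        using that by real_asymp
      then have "(\<lambda>n. \<epsilon> * (E n g * real n powr r) + ((sqrt (real n) + c) * F 1 t ^ n * real n powr r
          + (sqrt (real n) + c) * F (-1) u ^ n * real n powr r)) \<longlonglongrightarrow> \<epsilon> * C + (0 + 0)"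
        using lim t u F_pos unfolding E_def by (intro tendsto_intros) auto
      moreover have "\<epsilon> * C + (0 + 0) < e"
      proof -
        have "\<epsilon> * C \<le> \<epsilon> * (\<bar>C\<bar> + 1)" using \<open>0 < \<epsilon>\<close> by (intro mult_left_mono) auto
        also have "\<epsilon> * (\<bar>C\<bar> + 1) = e / 2" by (simp add: \<epsilon>_def field_simps)
        finally show ?thesis using \<open>0 < e\<close> by simp
      qed
      ultimately have "\<forall>\<^sub>F n in sequentially. \<epsilon> * (E n g * real n powr r) + ((sqrt (real n) + c) * F 1 t ^ n * real n powr r
          + (sqrt (real n) + c) * F (-1) u ^ n * real n powr r) < e"
        by (rule order_tendstoD)
      then show ?thesis by (simp add: algebra_simps)
    qed
    ultimately show "\<forall>\<^sub>F n in sequentially.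
      dist (E n (\<lambda>ws. (sqrt (real n) * stay_prob (moves k ws) 0 - c) * g ws) * real n powr r) 0 < e"
    proof eventually_elim
      case (elim n)
      have "\<bar>E n (\<lambda>ws. (sqrt (real n) * stay_prob (moves k ws) 0 - c) * g ws)\<bar> * real n powr r
        \<le> (\<epsilon> * E n g + (sqrt (real n) + c) * (F 1 t ^ n + F (-1) u ^ n)) * real n powr r"
        using elim(1) by (intro mult_right_mono) auto
      with elim(2) show ?case by (simp add: abs_mult)
    qed
  qed
  from tendsto_add[OF this tendsto_mult_left[OF lim, of c]]
  have "(\<lambda>n. E n (\<lambda>ws. (sqrt (real n) * stay_prob (moves k ws) 0 - c) * g ws) * real n powr r
      + c * (E n g * real n powr r)) \<longlonglongrightarrow> C * c"
    by (simp add: E_def mult.commute)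
  moreover have "E n (\<lambda>ws. (sqrt (real n) * stay_prob (moves k ws) 0 - c) * g ws) * real n powr r
      + c * (E n g * real n powr r)
    = E n (\<lambda>ws. stay_prob (moves k ws) 0 * g ws) * real n powr (r + 1 / 2)" for n
  proof -
    have "(\<lambda>ws. (sqrt (real n) * stay_prob (moves k ws) 0 - c) * g ws)
      = (\<lambda>ws. sqrt (real n) * (stay_prob (moves k ws) 0 * g ws) - c * g ws)"
      by (simp add: algebra_simps)
    then have "E n (\<lambda>ws. (sqrt (real n) * stay_prob (moves k ws) 0 - c) * g ws)
      = sqrt (real n) * E n (\<lambda>ws. stay_prob (moves k ws) 0 * g ws) - c * E n g"
      by (simp add: E_def walk_sum_diff walk_sum_cmult diff_divide_distrib)
    then show ?thesis by (simp only:) (simp add: powr_add powr_half_sqrt algebra_simps)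
  qed
  moreover have "c = sqrt (2 * W / (pi * M))"
    using \<open>0 < W\<close> by (simp add: c_def p_def real_sqrt_divide real_sqrt_mult field_simps)
  ultimately show ?thesis by (simp add: E_def)
qed

section \<open>From quadrant walks to products of \<open>stay_prob\<close>\<close>

lemma stays_nonneg_iff:
  "stays_nonneg k x ws \<longleftrightarrow> (\<forall>m\<le>length ws. 0 \<le> x + (\<Sum>i<m. (ws ! i) k))"
proof (induction ws arbitrary: x)
  case (Cons s ws)
  have "(\<forall>m\<le>length (s # ws). 0 \<le> x + (\<Sum>i<m. ((s # ws) ! i) k))
    \<longleftrightarrow> 0 \<le> x \<and> (\<forall>m\<le>length ws. 0 \<le> x + (\<Sum>i<Suc m. ((s # ws) ! i) k))"
    \<comment> \<open>The case \<open>m = 0\<close> is split off: it tests the start, while the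
      others contain the first step.\<close>
    unfolding All_less_Suc2[of "Suc (length ws)", unfolded less_Suc_eq_le] list.size add_Suc_right add_0_right
    by (simp del: sum.lessThan_Suc)
  then show ?case
    by (simp add: Cons.IH sum.lessThan_Suc_shift add.assoc del: sum.lessThan_Suc)
qed simp

lemma total_quadrant_weight_eq_walk_sum:
  assumes "finite S"
  shows "total_quadrant_weight d S w n
    = walk_sum S w n (\<lambda>ws. \<Prod>j<d. of_bool (stays_nonneg j 0 ws))"
proof -
  let ?L = "{ws. set ws \<subseteq> S \<and> length ws = n}"
  have "(\<Prod>j<d. of_bool (stays_nonneg j 0 ws)) = (of_bool (\<forall>j<d. stays_nonneg j 0 ws) :: real)" for ws
    by (induction d) (auto simp: less_Suc_eq)
  moreover have "quadrant_walks d S n = {ws \<in> ?L. \<forall>j<d. stays_nonneg j 0 ws}"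
    by (auto simp: quadrant_walks_def stays_nonneg_iff)
  moreover have "finite ?L" using assms by (rule finite_lists_length_eq)
  ultimately show ?thesis
    unfolding total_quadrant_weight_def walk_sum_def
    by (auto simp: sum.inter_filter intro!: sum.cong)
qed

lemma moves_reflect:
  "j \<noteq> k \<Longrightarrow> moves j (xs @ reflect k s # ys) = moves j (xs @ s # ys)"
  by (simp add: moves_def reflect_def)

lemma stays_nonneg_reflect:
  "j \<noteq> k \<Longrightarrow> stays_nonneg j x (xs @ reflect k s # ys) = stays_nonneg j x (xs @ s # ys)"
  by (induction xs arbitrary: x) (auto simp: reflect_def)

lemma sum_symmetric_over:
  assumes "symmetric_over S w k" and "\<And>s. s \<in> S \<Longrightarrow> f (reflect k s) = f s"
  shows "(\<Sum>s\<in>S. w s * (h (s k) * f s)) = (\<Sum>s\<in>S. w s * (h (- s k) * f s))"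
  using assms
  by (intro sum.reindex_bij_witness[where i = "reflect k" and j = "reflect k"])
     (auto simp: symmetric_over_def reflect_def)

lemma sum_three_valued:
  fixes w :: "(nat \<Rightarrow> int) \<Rightarrow> real"
  assumes "finite S" and "\<And>s. s \<in> S \<Longrightarrow> s k \<in> {-1, 0, 1}"
  shows "(\<Sum>s\<in>S. w s * h (s k)) = forward_weight S w k * h 1 + backward_weight S w k * h (-1)
    + (\<Sum>s\<in>{s\<in>S. s k = 0}. w s) * h 0"
proof -
  have "(\<Sum>s\<in>S. w s * h (s k)) = (\<Sum>s\<in>S. (if s k = 1 then w s else 0) * h 1
      + (if s k = -1 then w s else 0) * h (-1) + (if s k = 0 then w s else 0) * h 0)"
    using assms(2) by (intro sum.cong refl) fastforce
  then show ?thesis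
    using assms(1)
    by (simp add: sum.distrib sum_distrib_right[symmetric] forward_weight_def backward_weight_def
        sum.inter_filter)
qed

lemma forward_eq_backward:
  assumes "symmetric_over S w k"
  shows "forward_weight S w k = backward_weight S w k"
  unfolding forward_weight_def backward_weight_def
  using assms
  by (intro sum.reindex_bij_witness[where i = "reflect k" and j = "reflect k"])
     (auto simp: symmetric_over_def reflect_def)

text \<open>The coordinates are converted one at a time. All other factors, converted or not, ignore
  the signs in direction \<open>K\<close>, so they can play the role of \<open>f\<close> in
  \<open>walk_sum_stays_nonneg\<close>.\<close>

lemma total_quadrant_weight_symmetrized:
  assumes fin: "finite S" and small: "\<And>s j. s \<in> S \<Longrightarrow> j < d \<Longrightarrow> s j \<in> {-1, 0, 1}"
    and sym: "\<And>k. k < K \<Longrightarrow> symmetric_over S w k" and "K \<le> d"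
  shows "total_quadrant_weight d S w n
    = walk_sum S w n (\<lambda>ws. (\<Prod>j<K. stay_prob (moves j ws) 0) * (\<Prod>j=K..<d. of_bool (stays_nonneg j 0 ws)))"
  using sym \<open>K \<le> d\<close>
proof (induction K)
  case 0
  then show ?case
    using fin by (simp add: total_quadrant_weight_eq_walk_sum atLeast0LessThan)
next
  case (Suc K)
  let ?f = "\<lambda>ws. (\<Prod>j<K. stay_prob (moves j ws) 0) * (\<Prod>j=Suc K..<d. of_bool (stays_nonneg j 0 ws))"
  \<comment> \<open>Reflecting an entry at an arbitrary position is allowed, which makes the
    property pass from \<open>f\<close> to \<open>f\<close> after prepending a step.\<close>
  let ?P = "\<lambda>f :: (nat \<Rightarrow> int) list \<Rightarrow> real. \<forall>xs s ys. f (xs @ reflect K s # ys) = f (xs @ s # ys)"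
  have "total_quadrant_weight d S w n
    = walk_sum S w n (\<lambda>ws. of_bool (stays_nonneg K 0 ws) * ?f ws)"
    using Suc by (simp add: prod.atLeast_Suc_lessThan mult_ac)
  also have "\<dots> = walk_sum S w n (\<lambda>ws. stay_prob (moves K ws) 0 * ?f ws)"
  proof (rule walk_sum_stays_nonneg[where P = ?P])
    fix f s assume "?P f"
    then show "?P (\<lambda>ws. f (s # ws))" by (metis append_Cons)
  next
    fix f :: "(nat \<Rightarrow> int) list \<Rightarrow> real" and ws and h :: "int \<Rightarrow> real" assume "?P f"
    then have "f (reflect K s # ws) = f (s # ws)" for s by (metis append_Nil)
    then show "(\<Sum>s\<in>S. w s * (h (s K) * f (s # ws))) = (\<Sum>s\<in>S. w s * (h (- s K) * f (s # ws)))"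
      using Suc.prems by (intro sum_symmetric_over) auto
  next
    show "?P ?f"
      by (intro allI arg_cong2[where f = "(*)"] prod.cong) (auto simp: moves_reflect stays_nonneg_reflect)
  qed (use fin small Suc.prems in auto)
  also have "\<dots> = walk_sum S w n (\<lambda>ws. (\<Prod>j<Suc K. stay_prob (moves j ws) 0)
      * (\<Prod>j=Suc K..<d. of_bool (stays_nonneg j 0 ws)))"
    by (simp add: mult_ac)
  finally show ?case .
qed

section \<open>Combining the coordinates into the final limit\<close>

theorem mainTheorem1:
  fixes d :: nat and S :: "(nat \<Rightarrow> int) set" and w :: "(nat \<Rightarrow> int) \<Rightarrow> real"
  assumes "d \<ge> 1"
    and "finite S"
    and "\<forall>s\<in>S. valid_step d s"
    and "\<forall>s\<in>S. w s > 0"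
    and "\<forall>k < d - 1. symmetric_over S w k"
    and "\<forall>j < d. (\<exists>s\<in>S. s j = 1) \<and> (\<exists>s\<in>S. s j = -1)"
    and "backward_weight S w (d - 1) = forward_weight S w (d - 1)"
  shows "(\<lambda>n. total_quadrant_weight d S w n) \<sim>[at_top]
     (\<lambda>n. char_at_one S w ^ n * real n powr (- real d / 2) *
        (char_at_one S w powr (real d / 2) /
          (pi powr (real d / 2) * sqrt (\<Prod>k<d. forward_weight S w k))))"
proof -
  note fin = \<open>finite S\<close>
  have small: "s j \<in> {-1, 0, 1}" if "s \<in> S" "j < d" for s j
    using assms(3) that by (auto simp: valid_step_def)
  have w: "0 \<le> w s" if "s \<in> S" for s using assms(4) that by force
  define W where "W = sum w S"
  define b where "b = forward_weight S w"
  define l where "l = d - 1"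
  have d: "d = Suc l" using \<open>d \<ge> 1\<close> by (simp add: l_def)
  have bwd: "backward_weight S w j = b j" if "j < d" for j
    using that assms(5,7) forward_eq_backward[of S w j] d by (cases "j = l") (auto simp: b_def)
  have b_pos: "0 < b j" if "j < d" for j
    unfolding b_def forward_weight_def using assms(2,4,6) that by (intro sum_pos) auto
  have sum3: "(\<Sum>s\<in>S. w s * h (s j)) = b j * (h 1 + h (-1)) + (\<Sum>s\<in>{s\<in>S. s j = 0}. w s) * h 0"
    if "j < d" for j and h :: "int \<Rightarrow> real"
    using sum_three_valued[of S j w h] fin small that bwd by (auto simp: b_def algebra_simps)
  have M: "(\<Sum>s\<in>{s\<in>S. s j \<noteq> 0}. w s) = 2 * b j" if "j < d" for j
    using sum3[OF that, of "\<lambda>y. of_bool (y \<noteq> 0)"] fin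
    by (simp add: sum.inter_filter of_bool_def if_distrib cong: if_cong)
  obtain s0 where "s0 \<in> S" using assms(1,6) by force
  then have "0 < W" unfolding W_def using fin assms(4) by (intro sum_pos) auto
  define c where "c j = sqrt (W / (pi * b j))" for j
  have step: "(\<lambda>n. walk_sum S w n (\<lambda>ws. stay_prob (moves j ws) 0 * g ws) / W ^ n * real n powr (r + 1 / 2))
      \<longlonglongrightarrow> C * c j"
    if "j < d" "\<And>ws. 0 \<le> g ws" "\<And>ws. g ws \<le> 1"
      "(\<lambda>n. walk_sum S w n g / W ^ n * real n powr r) \<longlonglongrightarrow> C" for j g r C
  proof -
    have "2 * W / (pi * (2 * b j)) = W / (pi * b j)" by simp
    moreover have "(\<lambda>n. walk_sum S w n (\<lambda>ws. stay_prob (moves j ws) 0 * g ws) / sum w S ^ n * real n powr (r + 1 / 2))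
      \<longlonglongrightarrow> C * sqrt (2 * sum w S / (pi * (\<Sum>s\<in>{s\<in>S. s j \<noteq> 0}. w s)))"
      using that(2-) M[OF that(1)] b_pos[OF that(1)]
      by (intro walk_sum_stay_prob_asymptotics fin w) (simp_all add: W_def)
    ultimately show ?thesis
      unfolding M[OF that(1)] W_def[symmetric] c_def by simp
  qed
  \<comment> \<open>Reflection may fail in direction \<open>l\<close>, but for constant
    \<open>f\<close> zero drift already balances the signs.\<close>
  have last: "walk_sum S w n (\<lambda>ws. of_bool (stays_nonneg l 0 ws))
      = walk_sum S w n (\<lambda>ws. stay_prob (moves l ws) 0)" for n
  proof -
    have "(\<Sum>s\<in>S. w s * h (s l)) = (\<Sum>s\<in>S. w s * h (- s l))" for h :: "int \<Rightarrow> real"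
      using sum3[of l h] sum3[of l "\<lambda>y. h (- y)"] d by simp
    then have "walk_sum S w n (\<lambda>ws. of_bool (stays_nonneg l 0 ws) * 1)
      = walk_sum S w n (\<lambda>ws. stay_prob (moves l ws) 0 * 1)"
      using fin small d by (intro walk_sum_stays_nonneg[where P = "\<lambda>f. f = (\<lambda>_. 1)"]) auto
    then show ?thesis by simp
  qed
  \<comment> \<open>The event for the last coordinate is evaluated alone at \<open>K = 0\<close>,
    where \<open>last\<close> applies; the other factors are then multiplied on by
    \<open>step\<close>.\<close>
  have lim: "(\<lambda>n. walk_sum S w n (\<lambda>ws. (\<Prod>j<K. stay_prob (moves j ws) 0) * of_bool (stays_nonneg l 0 ws))
      / W ^ n * real n powr (real (Suc K) / 2)) \<longlonglongrightarrow> (\<Prod>j<K. c j) * c l" if "K \<le> l" for K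
    using that
  proof (induction K)
    case 0
    have "walk_sum S w n (\<lambda>ws. 1) = W ^ n" for n
      using walk_sum_exp_moves[OF fin, of w n 0] by (simp add: W_def)
    \<comment> \<open>Equality with 1 holds only for positive \<open>n\<close>, since
      \<open>0 powr 0 = 0\<close>.\<close>
    then have "(\<lambda>n. walk_sum S w n (\<lambda>ws. 1) / W ^ n * real n powr 0) \<longlonglongrightarrow> 1"
      using \<open>0 < W\<close> by (intro tendsto_eventually eventually_mono[OF eventually_gt_at_top[of 0]]) auto
    from step[OF _ _ _ this, of l] show ?case using d by (simp add: last)
  next
    case (Suc K)
    let ?g = "\<lambda>ws. (\<Prod>j<K. stay_prob (moves j ws) 0) * of_bool (stays_nonneg l 0 ws)"
    have "0 \<le> ?g ws" "?g ws \<le> 1" for ws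
      using stay_prob_bounds by (auto intro!: mult_le_one prod_nonneg prod_le_1)
    from step[OF _ this Suc.IH, of K] Suc.prems d show ?case
      by (simp add: mult_ac add_divide_distrib)
  qed
  have "total_quadrant_weight d S w n
      = walk_sum S w n (\<lambda>ws. (\<Prod>j<l. stay_prob (moves j ws) 0) * of_bool (stays_nonneg l 0 ws))" for n
    using total_quadrant_weight_symmetrized[of S d l w n] fin small assms(5) d by simp
  then have main: "(\<lambda>n. total_quadrant_weight d S w n / W ^ n * real n powr (real d / 2)) \<longlonglongrightarrow> (\<Prod>j<d. c j)"
    using lim[of l] d by simp
  have prod_c: "(\<Prod>j<m. c j) = W powr (real m / 2) / (pi powr (real m / 2) * sqrt (\<Prod>k<m. b k))" for m
    using \<open>0 < W\<close>
    by (induction m) (simp_all add: c_def add_divide_distrib powr_add powr_half_sqrt real_sqrt_divide real_sqrt_mult mult_ac)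
  define P where "P = (\<Prod>j<d. c j)"
  have "0 < P"
    unfolding P_def using b_pos \<open>0 < W\<close> by (intro prod_pos) (auto simp: c_def)
  then have "(\<lambda>n. total_quadrant_weight d S w n / W ^ n * real n powr (real d / 2) / P) \<longlonglongrightarrow> 1"
    using tendsto_divide[OF main[folded P_def] tendsto_const, of P] by simp
  then have "(\<lambda>n. total_quadrant_weight d S w n / (W ^ n * real n powr (- real d / 2) * P)) \<longlonglongrightarrow> 1"
    by (simp add: powr_minus field_simps)
  then have "(\<lambda>n. total_quadrant_weight d S w n) \<sim>[at_top]
      (\<lambda>n. W ^ n * real n powr (- real d / 2) * P)"
    by (rule asymp_equivI')
  then show ?thesis
    unfolding P_def prod_c b_def W_def char_at_one_def .
qed

end
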